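(* Given a fibration of $\mathbb R^n$ by pairwise skew oriented affine $k$-planes, there exists a $(k+1)$-dimensional (affine) plane in $\mathbb R^n$ transverse to all fibers.
   Context: A fibration of $\mathbb R^n$ by oriented affine $k$-planes is a family of pairwise disjoint oriented affine $k$-planes covering $\mathbb R^n$ such that the map sending $x\in\mathbb R^n$ to the fiber through $x$ (an element of the oriented affine Grassmannian) is continuous. It is skew if no two distinct fibers contain parallel lines. Two affine subspaces of $\mathbb R^n$ are called transverse if their linear translates (the parallel linear subspaces through $0$) intersect only in the origin; their dimensions need not be complementary.
   Formalization: The formal statement assumes k < n; for k = n the single fiber R^n is a vacuously skew fibration, and no (n+1)-dimensional plane exists in R^n. *)

theory Defs
  imports "HOL-Analysis.Analysis"
begin

text \<open>Ambient space: R^n is modelled by a Euclidean space type 'a with n = DIM('a).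
An oriented affine k-plane is presented by a framed point (p, v): a base point p and a
linearly independent frame v 0, ..., v (k-1) (with v i = 0 for i >= k).
Two framed points define the same oriented affine k-plane iff they span the same affine
plane and the change-of-frame matrix has positive determinant.  The oriented affine
Grassmannian is the set of these equivalence classes, with the quotient topology
coming from the space of frames.\<close>

type_synonym 'a oframe = "'a \<times> (nat \<Rightarrow> 'a)"

definition is_oframe :: "nat \<Rightarrow> 'a::euclidean_space oframe \<Rightarrow> bool" where
  "is_oframe k f \<longleftrightarrow> (\<forall>i\<ge>k. snd f i = 0) \<and> inj_on (snd f) {..<k}
      \<and> independent (snd f ` {..<k})"

definition oframes :: "nat \<Rightarrow> 'a::euclidean_space oframe set" where
  "oframes k = {f. is_oframe k f}"

definition frame_points :: "nat \<Rightarrow> 'a::euclidean_space oframe \<Rightarrow> 'a set" where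
  "frame_points k f = {fst f + u | u. u \<in> span (snd f ` {..<k})}"

definition ldet :: "nat \<Rightarrow> (nat \<Rightarrow> nat \<Rightarrow> real) \<Rightarrow> real" where
  "ldet k M = (\<Sum>\<sigma> | \<sigma> permutes {..<k}. of_int (sign \<sigma>) * (\<Prod>i<k. M i (\<sigma> i)))"

definition same_oplane :: "nat \<Rightarrow> 'a::euclidean_space oframe \<Rightarrow> 'a oframe \<Rightarrow> bool" where
  "same_oplane k f g \<longleftrightarrow> is_oframe k f \<and> is_oframe k g \<and>
     frame_points k f = frame_points k g \<and>
     (\<exists>M. (\<forall>j<k. snd g j = (\<Sum>i<k. M i j *\<^sub>R snd f i)) \<and> ldet k M > 0)"

definition oplane :: "nat \<Rightarrow> 'a::euclidean_space oframe \<Rightarrow> 'a oframe set" where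
  "oplane k f = {g. same_oplane k f g}"

definition OAGr :: "nat \<Rightarrow> 'a::euclidean_space oframe set set" where
  "OAGr k = oplane k ` oframes k"

definition oagr_open :: "nat \<Rightarrow> 'a::euclidean_space oframe set set \<Rightarrow> bool" where
  "oagr_open k S \<longleftrightarrow> S \<subseteq> OAGr k \<and>
     openin (top_of_set (oframes k)) {f \<in> oframes k. oplane k f \<in> S}"

definition opoints :: "nat \<Rightarrow> 'a::euclidean_space oframe set \<Rightarrow> 'a set" where
  "opoints k P = \<Union> (frame_points k ` P)"

definition fiber_through :: "nat \<Rightarrow> 'a::euclidean_space oframe set set \<Rightarrow> 'a \<Rightarrow> 'a oframe set" where
  "fiber_through k \<F> x = (THE P. P \<in> \<F> \<and> x \<in> opoints k P)"

definition oriented_fibration :: "nat \<Rightarrow> 'a::euclidean_space oframe set set \<Rightarrow> bool" where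
  "oriented_fibration k \<F> \<longleftrightarrow> \<F> \<subseteq> OAGr k \<and>
     (\<forall>P\<in>\<F>. \<forall>Q\<in>\<F>. P \<noteq> Q \<longrightarrow> opoints k P \<inter> opoints k Q = {}) \<and>
     (\<forall>x. \<exists>P\<in>\<F>. x \<in> opoints k P) \<and>
     (\<forall>S. oagr_open k S \<longrightarrow> open {x. fiber_through k \<F> x \<in> S})"

definition skew_fibration :: "nat \<Rightarrow> 'a::euclidean_space oframe set set \<Rightarrow> bool" where
  "skew_fibration k \<F> \<longleftrightarrow>
     (\<forall>P\<in>\<F>. \<forall>Q\<in>\<F>. P \<noteq> Q \<longrightarrow>
        \<not> (\<exists>a b u. u \<noteq> 0 \<and> range (\<lambda>t. a + t *\<^sub>R u) \<subseteq> opoints k P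
                      \<and> range (\<lambda>t. b + t *\<^sub>R u) \<subseteq> opoints k Q))"

definition lin_part :: "'a::real_vector set \<Rightarrow> 'a set" where
  "lin_part A = {x - y | x y. x \<in> A \<and> y \<in> A}"

definition transverse :: "'a::real_vector set \<Rightarrow> 'a set \<Rightarrow> bool" where
  "transverse A B \<longleftrightarrow> lin_part A \<inter> lin_part B = {0}"

end

theory Submission
  imports Defs
begin

text \<open>Place \<open>\<real>\<^sup>n\<close> at height 1 in \<open>\<real>\<^sup>n \<times> \<real>\<close>. The linear \<open>(k+1)\<close>-planes spanned by the fibers meet
  pairwise only in the origin, because the fibers are disjoint and skew, so by invariance of domain
  the planes close to a given one sweep out an open set away from the origin. The fibers recede
  to infinity, since the directions of fibers all meeting a fixed ball would deform the identity
  of a large sphere into a proper subspace. Let \<open>W\<close> be a limit of the \<open>(k+1)\<close>-planes spanned by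
  receding fibers; it lies at height 0. If \<open>W\<close> contained a direction of some fiber, the receding
  fibers would by openness have to coincide with fibers close to that one, which meet a fixed ball.\<close>

section \<open>Orthogonal projection onto a linear subspace\<close>

lemma closest_point_subspace_in:
  fixes S :: "'a::euclidean_space set"
  assumes "subspace S"
  shows "closest_point S u \<in> S"
  using assms closed_subspace subspace_0 by (blast intro: closest_point_in_set)

lemma closest_point_subspace_orthogonal:
  fixes S :: "'a::euclidean_space set"
  assumes S: "subspace S" and v: "v \<in> S"
  shows "(u - closest_point S u) \<bullet> v = 0"
proof -
  let ?p = "closest_point S u"
  have p: "?p \<in> S" using S by (rule closest_point_subspace_in)
  have *: "(u - ?p) \<bullet> (x - ?p) \<le> 0" if "x \<in> S" for x
    using closest_point_dot[OF subspace_imp_convex[OF S] closed_subspace[OF S] that] .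
  show ?thesis
    using *[of "?p + v"] *[of "?p - v"] p v S by (simp add: subspace_add subspace_diff)
qed

lemma closest_point_subspace_unique:
  fixes S :: "'a::euclidean_space set"
  assumes S: "subspace S" and p: "p \<in> S" and orth: "\<And>v. v \<in> S \<Longrightarrow> (u - p) \<bullet> v = 0"
  shows "closest_point S u = p"
proof -
  let ?q = "closest_point S u"
  have d: "?q - p \<in> S" using S p by (simp add: closest_point_subspace_in subspace_diff)
  have "(?q - p) \<bullet> (?q - p) = (u - p) \<bullet> (?q - p) - (u - ?q) \<bullet> (?q - p)"
    by (simp add: algebra_simps)
  also have "\<dots> = 0"
    using orth[OF d] closest_point_subspace_orthogonal[OF S d] by simp
  finally show ?thesis by simp
qed

lemma closest_point_subspace_diff:
  fixes S :: "'a::euclidean_space set"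
  assumes S: "subspace S"
  shows "closest_point S (u - v) = closest_point S u - closest_point S v"
proof (rule closest_point_subspace_unique[OF S])
  show "closest_point S u - closest_point S v \<in> S"
    using S by (simp add: closest_point_subspace_in subspace_diff)
  fix w assume "w \<in> S"
  then show "(u - v - (closest_point S u - closest_point S v)) \<bullet> w = 0"
    using closest_point_subspace_orthogonal[OF S, of w u]
      closest_point_subspace_orthogonal[OF S, of w v]
    by (simp add: inner_diff_left)
qed

lemma closest_point_subspace_scaleR:
  fixes S :: "'a::euclidean_space set"
  assumes S: "subspace S"
  shows "closest_point S (c *\<^sub>R u) = c *\<^sub>R closest_point S u"
proof (rule closest_point_subspace_unique[OF S])
  show "c *\<^sub>R closest_point S u \<in> S"
    using S by (simp add: closest_point_subspace_in subspace_scale)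
  fix w assume "w \<in> S"
  then show "(c *\<^sub>R u - c *\<^sub>R closest_point S u) \<bullet> w = 0"
    using closest_point_subspace_orthogonal[OF S, of w u]
    by (simp flip: scaleR_diff_right)
qed

lemma closest_point_subspace_dist_le:
  fixes S :: "'a::euclidean_space set"
  assumes S: "subspace S"
  shows "dist (closest_point S u) (closest_point S v) \<le> dist u v"
  using closest_point_lipschitz[OF subspace_imp_convex[OF S] closed_subspace[OF S]] subspace_0[OF S]
  by blast

section \<open>The projection as an explicit Gram-Schmidt formula in a frame\<close>

fun gram_schmidt_proj :: "nat \<Rightarrow> (nat \<Rightarrow> 'a::euclidean_space) \<Rightarrow> 'a \<Rightarrow> 'a" where
  "gram_schmidt_proj 0 v u = 0"
| "gram_schmidt_proj (Suc m) v u =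
     (let w = v m - gram_schmidt_proj m v (v m)
      in gram_schmidt_proj m v u + ((u \<bullet> w) / (w \<bullet> w)) *\<^sub>R w)"

lemma gram_schmidt_proj_eq:
  "gram_schmidt_proj m v u = closest_point (span (v ` {..<m})) u"
proof (induction m arbitrary: u)
  case 0
  then show ?case
    using closest_point_subspace_in[OF subspace_span, of "{}" u] by simp
next
  case (Suc m)
  let ?S = "span (v ` {..<m})" and ?T = "span (v ` {..<Suc m})"
  define p where "p = gram_schmidt_proj m v"
  define w where "w = v m - p (v m)"
  define q where "q = p u + ((u \<bullet> w) / (w \<bullet> w)) *\<^sub>R w"
  have pS: "p x \<in> ?S" for x
    unfolding p_def Suc.IH by (rule closest_point_subspace_in[OF subspace_span])
  have po: "(x - p x) \<bullet> s = 0" if "s \<in> ?S" for x s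
    unfolding p_def Suc.IH using that by (rule closest_point_subspace_orthogonal[OF subspace_span])
  have ST: "?S \<subseteq> ?T" by (rule span_mono) auto
  have vT: "v m \<in> ?T" by (rule span_base) auto
  have wT: "w \<in> ?T" unfolding w_def using vT pS ST by (meson span_diff subsetD)
  have wS: "w \<bullet> s = 0" if "s \<in> ?S" for s
    unfolding w_def using that by (rule po)
  have qT: "q \<in> ?T"
    unfolding q_def using wT pS ST by (meson span_add span_scale subsetD)
  have qS: "(u - q) \<bullet> s = 0" if "s \<in> ?S" for s
    using po[OF that, of u] wS[OF that] by (simp add: q_def inner_diff_left inner_add_left)
  \<comment> \<open>If \<open>v m\<close> already lies in the earlier span, then
    \<open>w = 0\<close>, and division by zero yields 0, so the extra term vanishes as it
    should.\<close>
  have qw: "(u - q) \<bullet> w = 0"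
    using wS[OF pS, of u]
    by (cases "w = 0") (simp_all add: q_def inner_diff_right inner_add_right inner_commute)
  have qv: "(u - q) \<bullet> v m = 0"
    using qw qS[OF pS, of "v m"] by (simp add: w_def inner_diff_right)
  have qi: "(u - q) \<bullet> v i = 0" if "i < Suc m" for i
    using that qv qS[OF span_base, of "v i"] by (auto simp: less_Suc_eq)
  have "(u - q) \<bullet> t = 0" if "t \<in> ?T" for t
  proof -
    have "orthogonal (u - q) t"
      by (rule orthogonal_to_span[OF that])
        (auto simp: orthogonal_def qi)
    then show ?thesis by (simp add: orthogonal_def)
  qed
  then have "closest_point ?T u = q"
    using qT by (intro closest_point_subspace_unique subspace_span)
  then show ?case by (simp add: q_def w_def p_def Let_def)
qed

text \<open>Independence keeps the divisor \<open>w \<bullet> w\<close> of the formula nonzero. The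
  projected vector \<open>h\<close> must vary with \<open>x\<close> because the recursion also
  projects the frame vector \<open>g x m\<close>.\<close>

lemma continuous_on_gram_schmidt_proj:
  fixes g :: "'b::topological_space \<Rightarrow> nat \<Rightarrow> 'a::euclidean_space"
  assumes "\<And>i. i < m \<Longrightarrow> continuous_on X (\<lambda>x. g x i)"
    and "\<And>x. x \<in> X \<Longrightarrow> inj_on (g x) {..<m} \<and> independent (g x ` {..<m})"
    and "continuous_on X h"
  shows "continuous_on X (\<lambda>x. gram_schmidt_proj m (g x) (h x))"
  using assms
proof (induction m arbitrary: h)
  case 0
  then show ?case by simp
next
  case (Suc m)
  have sub: "inj_on (g x) {..<m} \<and> independent (g x ` {..<m})" if "x \<in> X" for x
    using Suc.prems(2)[OF that]
    by (meson image_mono independent_mono inj_on_subset lessThan_subset_iff lessI less_imp_le)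
  have IH: "continuous_on X (\<lambda>x. gram_schmidt_proj m (g x) (f x))" if "continuous_on X f" for f
    by (rule Suc.IH) (use Suc.prems(1) sub that in auto)
  have gm: "continuous_on X (\<lambda>x. g x m)" using Suc.prems(1) by simp
  have nz: "g x m - gram_schmidt_proj m (g x) (g x m) \<noteq> 0" if "x \<in> X" for x
  proof
    assume "g x m - gram_schmidt_proj m (g x) (g x m) = 0"
    then have "g x m = closest_point (span (g x ` {..<m})) (g x m)"
      by (simp add: gram_schmidt_proj_eq)
    then have "g x m \<in> span (g x ` {..<m})"
      by (metis closest_point_subspace_in subspace_span)
    moreover have "g x ` {..<m} = g x ` {..<Suc m} - {g x m}"
      using Suc.prems(2)[OF that] by (auto simp: inj_on_def less_Suc_eq)
    ultimately show False
      using Suc.prems(2)[OF that] by (auto simp: dependent_def)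
  qed
  show ?case
    unfolding gram_schmidt_proj.simps Let_def
    by (intro continuous_intros IH gm Suc.prems(3)) (use nz in auto)
qed

section \<open>Continuous fields of planes\<close>

text \<open>\<open>V x\<close> stands for the direction of the fiber through \<open>x\<close>. Its
  continuity is expressed through the projections of fixed vectors, so no topology on a Grassmannian
  is involved.\<close>

locale plane_field =
  fixes V :: "'a::euclidean_space \<Rightarrow> 'a set"
  assumes subspace_V: "subspace (V x)"
    and continuous_proj: "continuous_on UNIV (\<lambda>x. closest_point (V x) u)"
begin

abbreviation proj :: "'a \<Rightarrow> 'a \<Rightarrow> 'a" where
  "proj x \<equiv> closest_point (V x)"

lemmas proj_in = closest_point_subspace_in[OF subspace_V]
  and proj_orth = closest_point_subspace_orthogonal[OF subspace_V]
  and proj_diff = closest_point_subspace_diff[OF subspace_V]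
  and proj_scaleR = closest_point_subspace_scaleR[OF subspace_V]
  and proj_dist_le = closest_point_subspace_dist_le[OF subspace_V]

lemma proj_self: "u \<in> V x \<Longrightarrow> proj x u = u"
  by (simp add: closest_point_self)

lemma span_V: "span (V x) = V x"
  using subspace_V by (rule span_eq_iff[THEN iffD2])

text \<open>Joint continuity follows from separate continuity since every projection is 1-Lipschitz,
  whatever the plane.\<close>

lemma continuous_on_proj:
  assumes f: "continuous_on S f" and g: "continuous_on S g"
  shows "continuous_on S (\<lambda>z. proj (f z) (g z))"
  unfolding continuous_on_def
proof
  fix z assume z: "z \<in> S"
  have 1: "((\<lambda>y. proj (f y) (g z)) \<longlongrightarrow> proj (f z) (g z)) (at z within S)"
    using continuous_on_compose2[OF continuous_proj[of "g z"] f] z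
    by (auto simp: continuous_on_def)
  have g': "(g \<longlongrightarrow> g z) (at z within S)" using g z by (auto simp: continuous_on_def)
  have "((\<lambda>y. dist (proj (f y) (g y)) (proj (f y) (g z))) \<longlongrightarrow> 0) (at z within S)"
    by (rule tendsto_sandwich[OF _ _ tendsto_const g'[unfolded tendsto_dist_iff[of g]]])
      (auto intro!: always_eventually proj_dist_le)
  then have 2: "((\<lambda>y. proj (f y) (g y) - proj (f y) (g z)) \<longlongrightarrow> 0) (at z within S)"
    by (simp add: dist_norm tendsto_norm_zero_iff)
  show "((\<lambda>y. proj (f y) (g y)) \<longlongrightarrow> proj (f z) (g z)) (at z within S)"
    using tendsto_add[OF 2 1] by simp
qed

text \<open>Uniform continuity on \<open>K\<close> times the unit ball, extended to all vectors by
  homogeneity: the projections vary uniformly continuously in operator norm.\<close>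

lemma uniformly_close_proj:
  assumes K: "compact K" and e: "e > 0"
  shows "\<exists>d>0. \<forall>x\<in>K. \<forall>y\<in>K. dist x y < d \<longrightarrow> (\<forall>u. norm (proj x u - proj y u) \<le> e * norm u)"
proof -
  let ?D = "K \<times> cball (0::'a) 1"
  have "uniformly_continuous_on ?D (\<lambda>z. proj (fst z) (snd z))"
    by (intro compact_uniformly_continuous continuous_on_proj continuous_intros compact_Times K)
      auto
  then obtain d where d: "d > 0"
    "\<And>z z'. z \<in> ?D \<Longrightarrow> z' \<in> ?D \<Longrightarrow> dist z' z < d \<Longrightarrow>
       dist (proj (fst z') (snd z')) (proj (fst z) (snd z)) < e"
    using e unfolding uniformly_continuous_on_def by meson
  have "norm (proj x u - proj y u) \<le> e * norm u" if "x \<in> K" "y \<in> K" "dist x y < d" for x y u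
  proof (cases "u = 0")
    case True
    then show ?thesis using proj_scaleR[of _ 0 0] by simp
  next
    case False
    let ?u = "(1 / norm u) *\<^sub>R u"
    have "dist (proj x ?u) (proj y ?u) < e"
      using d(2)[of "(y, ?u)" "(x, ?u)"] that False by (simp add: dist_Pair_Pair)
    then have "norm (proj x u - proj y u) / norm u < e"
      by (simp only: proj_scaleR dist_norm flip: scaleR_diff_right) simp
    then show ?thesis using False by (simp add: divide_simps mult.commute split: if_splits)
  qed
  then show ?thesis using d(1) by blast
qed

end

section \<open>The fibers recede to infinity\<close>

lemma closed_segment_nonzero:
  fixes a b :: "'a::real_normed_vector"
  assumes "norm (a - b) < norm a"
  shows "closed_segment a b \<subseteq> - {0}"
  using segment_bound(1)[of 0 a b] assms by (auto simp: norm_minus_commute)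

text \<open>A nullhomotopy would extend the inclusion to a nonvanishing map of the ball, and
  rescaling that map to norm \<open>r\<close> would retract the ball onto its sphere.\<close>

lemma sphere_inclusion_not_nullhomotopic:
  fixes c :: "'a::euclidean_space"
  assumes r: "r > 0"
  shows "\<not> homotopic_with_canon (\<lambda>_. True) (sphere 0 r) (- {0}) (\<lambda>x. x) (\<lambda>_. c)"
proof
  assume "homotopic_with_canon (\<lambda>_. True) (sphere 0 r) (- {0}) (\<lambda>x. x) (\<lambda>_. c)"
  then obtain g :: "'a \<Rightarrow> 'a" where g: "continuous_on (cball 0 r) g"
      "g ` cball 0 r \<subseteq> - {0}" "\<And>x. x \<in> sphere 0 r \<Longrightarrow> g x = x"
    using nullhomotopic_from_sphere_extension[of 0 r "- {0}" "\<lambda>x. x"] by blast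
  have nz: "g x \<noteq> 0" if "x \<in> cball 0 r" for x using g(2) that by blast
  have "retraction (cball 0 r) (sphere 0 r) (\<lambda>x. (r / norm (g x)) *\<^sub>R g x)"
    unfolding retraction_def
    using nz r g(3) by (auto intro!: continuous_intros g(1))
  then have "frontier (cball (0::'a) r) retract_of cball 0 r"
    using r by (auto simp: retract_of_def)
  then show False using no_retraction_cball[OF r] by blast
qed

context plane_field
begin

text \<open>If the planes stayed within bounded distance of the origin, the identity of a large sphere would
  be close to its projection. Projecting successively onto the planes at points closer and closer
  to the origin (a discrete parallel transport) deforms it to a map into the proper subspace
  \<^term>\<open>V 0\<close> without ever vanishing, so it would be nullhomotopic.\<close>

lemma foot_unbounded:
  assumes V0: "V 0 \<noteq> UNIV"
  shows "\<exists>x. R < norm (x - proj x x)"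
proof (rule ccontr)
  assume "\<not> ?thesis"
  then have R: "norm (x - proj x x) \<le> R" for x by (simp add: not_less)
  \<comment> \<open>A point of norm \<open>r > R\<close> is farther from 0 than from its projection,
    so the segment to the projection misses 0.\<close>
  define r where "r = R + 1"
  have r: "r > 0" using R[of 0] norm_ge_zero[of "0 - proj 0 0"] unfolding r_def by linarith
  let ?S = "sphere (0::'a) r"
  let ?H = "homotopic_with_canon (\<lambda>_. True) ?S (- {0})"
  obtain d where d: "d > 0" and close: "\<And>x y u. x \<in> cball 0 r \<Longrightarrow> y \<in> cball 0 r \<Longrightarrow>
      dist x y < d \<Longrightarrow> norm (proj x u - proj y u) \<le> 1/2 * norm u"
    using uniformly_close_proj[OF compact_cball[of 0 r], of "1/2"] by auto
  \<comment> \<open>The radius is cut into \<open>N\<close> steps of length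
    \<open>r / N < d\<close>; \<open>y j x\<close> runs from \<open>x\<close> at
    \<open>j = 0\<close> to the origin at \<open>j = N\<close>, and \<open>s j x\<close> is the
    vector transported into \<open>V (y j x)\<close>.\<close>
  obtain N :: nat where N: "r / d < real N" using reals_Archimedean2 by blast
  then have N0: "N > 0" using r d by (cases N) (auto simp: field_simps)
  define y where "y j x = (1 - real j / real N) *\<^sub>R x" for j and x :: 'a
  define s where "s = rec_nat (\<lambda>x. proj x x) (\<lambda>j f x. proj (y (Suc j) x) (f x))"
  have s0: "s 0 = (\<lambda>x. proj x x)" and sS: "s (Suc j) = (\<lambda>x. proj (y (Suc j) x) (s j x))" for j
    by (simp_all add: s_def)
  have "continuous_on ?S (s j) \<and> (\<forall>x\<in>?S. s j x \<in> V (y j x) \<and> s j x \<noteq> 0) \<and> ?H (\<lambda>x. x) (s j)"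
    if "j \<le> N" for j
    using that
  proof (induction j)
    case 0
    have c: "continuous_on ?S (s 0)" unfolding s0 by (intro continuous_on_proj continuous_intros)
    have seg: "closed_segment x (s 0 x) \<subseteq> - {0}" if "x \<in> ?S" for x
      using R[of x] that by (intro closed_segment_nonzero) (simp add: s0 r_def)
    have "s 0 x \<in> V (y 0 x) \<and> s 0 x \<noteq> 0" if "x \<in> ?S" for x
      using seg[OF that] ends_in_segment(2)[of "s 0 x" x] by (auto simp: s0 y_def proj_in)
    then show ?case using c seg by (auto intro!: homotopic_with_linear continuous_intros)
  next
    case (Suc j)
    then have IH: "continuous_on ?S (s j)" "\<And>x. x \<in> ?S \<Longrightarrow> s j x \<in> V (y j x) \<and> s j x \<noteq> 0"
        "?H (\<lambda>x. x) (s j)" by auto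
    have c: "continuous_on ?S (s (Suc j))"
      unfolding sS y_def by (intro continuous_on_proj continuous_intros IH(1))
    have seg: "closed_segment (s j x) (s (Suc j) x) \<subseteq> - {0}" if x: "x \<in> ?S" for x
    proof (rule closed_segment_nonzero)
      have "norm (y i x) \<le> r" if "i \<le> N" for i
      proof -
        have "\<bar>1 - real i / real N\<bar> \<le> 1" using that N0 by (simp add: abs_if divide_simps)
        then show ?thesis using x r by (simp add: y_def mult_left_le_one_le)
      qed
      then have yy: "y j x \<in> cball 0 r" "y (Suc j) x \<in> cball 0 r"
        using Suc.prems by auto
      have "y j x - y (Suc j) x = (1 / real N) *\<^sub>R x"
        by (simp add: y_def add_divide_distrib flip: scaleR_diff_left)
      then have "dist (y j x) (y (Suc j) x) < d"
        using x N N0 d by (simp add: dist_norm field_simps)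
      \<comment> \<open>One transport step moves a vector by at most half its norm, so the
        straight-line homotopy avoids 0.\<close>
      from close[OF yy this, of "s j x"] have "norm (s j x - s (Suc j) x) \<le> 1/2 * norm (s j x)"
        using IH(2)[OF x] by (simp add: sS proj_self)
      also have "\<dots> < norm (s j x)" using IH(2)[OF x] by simp
      finally show "norm (s j x - s (Suc j) x) < norm (s j x)" .
    qed
    have "?H (s j) (s (Suc j))" by (intro homotopic_with_linear IH(1) c seg)
    then have "?H (\<lambda>x. x) (s (Suc j))" using IH(3) by (rule homotopic_with_trans[rotated])
    moreover have "s (Suc j) x \<in> V (y (Suc j) x) \<and> s (Suc j) x \<noteq> 0" if "x \<in> ?S" for x
      using seg[OF that] ends_in_segment(2)[of "s (Suc j) x" "s j x"] by (auto simp: sS proj_in)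
    ultimately show ?case using c by blast
  qed
  from this[of N] have sN: "continuous_on ?S (s N)"
      "\<And>x. x \<in> ?S \<Longrightarrow> s N x \<in> V 0 \<and> s N x \<noteq> 0" "?H (\<lambda>x. x) (s N)"
    using N0 by (auto simp: y_def)
  \<comment> \<open>A normal \<open>e\<close> to \<open>V 0\<close> ends the contraction:
    \<open>s N x\<close> and \<open>e\<close> are orthogonal and nonzero, so no point of the segment
    between them is 0.\<close>
  have "span (V 0) \<subset> span UNIV" using V0 by (auto simp: span_V)
  then obtain e where e: "e \<noteq> 0" "\<And>v. v \<in> V 0 \<Longrightarrow> e \<bullet> v = 0"
    by (rule orthogonal_to_subspace_exists_gen) (auto simp: span_V orthogonal_def)
  have "closed_segment (s N x) e \<subseteq> - {0}" if x: "x \<in> ?S" for x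
  proof -
    have "s N x \<bullet> s N x > 0" "e \<bullet> s N x = 0" "e \<bullet> e > 0" using sN(2)[OF x] e by auto
    then have "(1 - a) *\<^sub>R s N x + a *\<^sub>R e \<noteq> 0" for a
    proof -
      have "((1 - a) *\<^sub>R s N x + a *\<^sub>R e) \<bullet> e = a * (e \<bullet> e)"
        "((1 - a) *\<^sub>R s N x + a *\<^sub>R e) \<bullet> s N x = (1 - a) * (s N x \<bullet> s N x)"
        using \<open>e \<bullet> s N x = 0\<close> inner_commute[of e "s N x"] by (simp_all add: inner_add_left)
      then show ?thesis using \<open>s N x \<bullet> s N x > 0\<close> \<open>e \<bullet> e > 0\<close> by fastforce
    qed
    then show ?thesis by (auto simp: closed_segment_def)
  qed
  then have "?H (s N) (\<lambda>_. e)" by (intro homotopic_with_linear sN(1) continuous_intros)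
  with sN(3) have "?H (\<lambda>x. x) (\<lambda>_. e)" by (rule homotopic_with_trans)
  then show False using sphere_inclusion_not_nullhomotopic[OF r] by blast
qed

end

section \<open>Skew fields of planes\<close>

text \<open>The fibers here are the planes \<open>x + V x\<close>. \<open>V_eq\<close> makes them
  agree whenever one passes through a point of the other, and \<open>skew\<close> makes fibers with
  a common direction coincide.\<close>

locale skew_field = plane_field +
  assumes V_eq: "y - x \<in> V x \<Longrightarrow> V y = V x"
    and skew: "u \<in> V x \<Longrightarrow> u \<in> V y \<Longrightarrow> u \<noteq> 0 \<Longrightarrow> y - x \<in> V x"
begin

text \<open>Geometrically: the linear cones over two distinct fibers placed at height 1 meet only in the
  origin.\<close>

lemma cone_meet:
  assumes v: "v \<in> V x" "v' \<in> V y" and eq: "t *\<^sub>R x + v = t *\<^sub>R y + v'"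
    and nz: "t \<noteq> 0 \<or> v \<noteq> 0"
  shows "y - x \<in> V x"
proof (cases "t = 0")
  case True
  then show ?thesis using skew[of v x y] assms by auto
next
  case False
  \<comment> \<open>Rescaling the common cone point to height 1 gives a point on both
    fibers.\<close>
  define z where "z = x + (1 / t) *\<^sub>R v"
  have "z = (1 / t) *\<^sub>R (t *\<^sub>R x + v)" using False by (simp add: z_def scaleR_add_right)
  also have "\<dots> = y + (1 / t) *\<^sub>R v'" using False unfolding eq by (simp add: scaleR_add_right)
  finally have "z - y = (1 / t) *\<^sub>R v'" by simp
  moreover have "z - x = (1 / t) *\<^sub>R v" by (simp add: z_def)
  ultimately have z: "z - x = (1 / t) *\<^sub>R v" "z - y = (1 / t) *\<^sub>R v'" by blast+
  have m: "z - x \<in> V x" "z - y \<in> V y" using v subspace_V by (auto simp: z intro: subspace_scale)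
  have "V x = V y" using V_eq[OF m(1)] V_eq[OF m(2)] by simp
  then have "(z - x) - (z - y) \<in> V x" using subspace_diff[OF subspace_V m(1), of "z - y"] m(2) by simp
  then show ?thesis by simp
qed

text \<open>The cones over the fibers near \<^term>\<open>q\<close> sweep out an open set, by invariance of domain;
  \<^term>\<open>w\<close> is the point at infinity \<open>(w, 0)\<close> of the cone over the fiber through \<^term>\<open>q\<close>.\<close>

lemma cones_near_fiber:
  assumes w: "w \<in> V q" "w \<noteq> 0"
  shows "\<exists>e>0. \<forall>x v t. v \<in> V x \<longrightarrow> dist (t *\<^sub>R x + v, t) (w, 0) < e \<longrightarrow>
           (\<exists>y. dist q y < 1 \<and> y - x \<in> V x)"
proof -
  obtain d0 where d0: "d0 > 0" and close0: "\<And>x y u. x \<in> cball q 1 \<Longrightarrow> y \<in> cball q 1 \<Longrightarrow>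
      dist x y < d0 \<Longrightarrow> norm (proj x u - proj y u) \<le> 1/2 * norm u"
    using uniformly_close_proj[OF compact_cball[of q 1], of "1/2"] by auto
  define d where "d = min d0 1"
  have d: "d > 0" "d \<le> 1" using d0 by (auto simp: d_def)
  have close: "norm (proj q u - proj y u) \<le> 1/2 * norm u" if "dist q y < d" for y u
    using close0[of q y u] that by (auto simp: d_def)
  \<comment> \<open>\<open>Y\<close> takes values in the slice through \<open>q\<close> orthogonal
    to \<open>V q\<close>. In \<Psi> the part of a vector orthogonal to \<open>V q\<close> selects a
    fiber, its part in \<open>V q\<close> a direction vector of that fiber, and the real coordinate
    the height; both sides thus have the same dimension. \<open>U\<close> excludes a zero direction
    vector, so the common apex of the cones is not hit.\<close>
  define Y where "Y z = q + (z - proj q z)" for z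
  have cY: "continuous_on S (\<lambda>z. Y (f z))" if "continuous_on S f" for S and f :: "'a \<times> real \<Rightarrow> 'a"
    unfolding Y_def by (intro continuous_intros continuous_on_proj that)
  define \<Psi> where "\<Psi> z = (snd z *\<^sub>R Y (fst z) + proj (Y (fst z)) (proj q (fst z)), snd z)"
    for z :: "'a \<times> real"
  define U where "U = {z :: 'a \<times> real. dist q (Y (fst z)) < d} \<inter> {z. proj q (fst z) \<noteq> 0}"
  have c\<Psi>: "continuous_on U \<Psi>"
    unfolding \<Psi>_def by (intro continuous_intros continuous_on_proj cY)
  have "open U"
    unfolding U_def
    by (intro open_Int open_Collect_less open_Collect_neq continuous_intros continuous_on_proj cY)
  have "inj_on \<Psi> U"
  proof (rule inj_onI)
    fix a b assume a: "a \<in> U" and b: "b \<in> U" and "\<Psi> a = \<Psi> b"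
    then have t: "snd a = snd b" and
      eq: "snd a *\<^sub>R Y (fst a) + proj (Y (fst a)) (proj q (fst a)) =
           snd a *\<^sub>R Y (fst b) + proj (Y (fst b)) (proj q (fst b))"
      by (auto simp: \<Psi>_def)
    let ?x = "Y (fst a)" and ?y = "Y (fst b)"
    \<comment> \<open>Closeness to \<open>V q\<close> makes the projection from \<open>V q\<close>
      to the nearby plane injective.\<close>
    have inj: "u = 0" if "u \<in> V q" "proj ?x u = 0" for u
      using close[of ?x u] a that by (simp add: U_def proj_self)
    have "proj ?x (proj q (fst a)) \<noteq> 0"
      using inj[OF proj_in[of q "fst a"]] a by (auto simp: U_def)
    then have xy: "?y - ?x \<in> V ?x" by (intro cone_meet[OF proj_in proj_in eq]) auto
    \<comment> \<open>The difference of two slice points is orthogonal to \<open>V q\<close>, yet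
      lies in the nearby plane \<open>V ?x\<close>; closeness forces it to vanish.\<close>
    have "proj q (?y - ?x) = 0"
      by (simp add: Y_def proj_diff proj_self proj_in)
    then have "?y - ?x = 0"
      using close[of ?x "?y - ?x"] a xy by (simp add: U_def proj_self norm_minus_commute)
    then have eqY: "?x = ?y" by simp
    with eq have "proj ?x (proj q (fst a) - proj q (fst b)) = 0" by (simp add: proj_diff)
    then have "proj q (fst a) = proj q (fst b)"
      using inj[of "proj q (fst a) - proj q (fst b)"] subspace_V
      by (simp add: proj_in subspace_diff)
    then show "a = b" using eqY t by (simp add: Y_def prod_eq_iff)
  qed
  then have "open (\<Psi> ` U)" using invariance_of_domain c\<Psi> \<open>open U\<close> by blast
  moreover have "(w, 0) \<in> \<Psi> ` U"
    using w d by (intro image_eqI[of _ _ "(w, 0)"]) (simp_all add: \<Psi>_def U_def Y_def proj_self)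
  ultimately obtain e where e: "e > 0" "ball (w, 0) e \<subseteq> \<Psi> ` U"
    using open_contains_ball by blast
  have "\<exists>y. dist q y < 1 \<and> y - x \<in> V x"
    if v: "v \<in> V x" and near: "dist (t *\<^sub>R x + v, t) (w, 0) < e" for x v t
  proof -
    have "(t *\<^sub>R x + v, t) \<in> \<Psi> ` U" using e(2) near by (auto simp: dist_commute)
    then obtain a where a: "a \<in> U" "\<Psi> a = (t *\<^sub>R x + v, t)" by force
    let ?y = "Y (fst a)" and ?v = "proj (Y (fst a)) (proj q (fst a))"
    have eq: "t *\<^sub>R x + v = t *\<^sub>R ?y + ?v" using a(2) by (auto simp: \<Psi>_def)
    have "?v \<noteq> 0"
      using close[of ?y "proj q (fst a)"] a(1) by (auto simp: U_def proj_self proj_in)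
    then have "t \<noteq> 0 \<or> v \<noteq> 0" using eq by auto
    then have "?y - x \<in> V x" using cone_meet[OF v proj_in eq] by blast
    moreover have "dist q ?y < 1" using a(1) d by (auto simp: U_def)
    ultimately show ?thesis by blast
  qed
  then show ?thesis using e(1) by blast
qed

end

section \<open>A limit of the spans of receding fibers\<close>

text \<open>Applied to orthonormal bases, this stands in for compactness of the
  Grassmannian.\<close>

lemma convergent_subsequence_finite:
  fixes b :: "nat \<Rightarrow> nat \<Rightarrow> 'a::euclidean_space"
  assumes "\<And>i j. j < m \<Longrightarrow> norm (b i j) \<le> C"
  shows "\<exists>l r. strict_mono r \<and> (\<forall>j<m. (\<lambda>i. b (r i) j) \<longlonglongrightarrow> l j)"
  using assms
proof (induction m)
  case 0
  show ?case by (rule exI, rule exI[of _ id]) (simp add: strict_mono_def)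
next
  case (Suc m)
  then obtain l r where r: "strict_mono r" "\<And>j. j < m \<Longrightarrow> (\<lambda>i. b (r i) j) \<longlonglongrightarrow> l j" by auto
  have "\<forall>i. b (r i) m \<in> cball 0 C" using Suc.prems by simp
  then obtain c q where q: "strict_mono q" "((\<lambda>i. b (r i) m) \<circ> q) \<longlonglongrightarrow> c"
    using compact_cball[of "0::'a" C] unfolding compact_eq_seq_compact_metric seq_compact_def
    by metis
  have "(\<lambda>i. b ((r \<circ> q) i) j) \<longlonglongrightarrow> (l(m := c)) j" if "j < Suc m" for j
  proof (cases "j = m")
    case True
    then show ?thesis using q(2) by (simp add: o_def)
  next
    case False
    then show ?thesis
      using LIMSEQ_subseq_LIMSEQ[OF r(2)[of j] q(1)] that by (simp add: o_def)
  qed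
  then show ?case using strict_mono_o[OF r(1) q(1)] by blast
qed

context skew_field
begin

lemma transverse_plane_exists:
  assumes dim: "\<And>x. dim (V x) = k" and k: "k < DIM('a)"
  shows "\<exists>W. subspace W \<and> dim W = k + 1 \<and> (\<forall>q. V q \<inter> W = {0})"
proof -
  have "V 0 \<noteq> UNIV" using dim[of 0] k by auto
  then have "\<forall>i. \<exists>x. real i < norm (x - proj x x)" using foot_unbounded by blast
  then obtain x' where x': "\<And>i. real i < norm (x' i - proj (x' i) (x' i))" by metis
  \<comment> \<open>The point of the fiber through \<open>x' i\<close> nearest to the origin; its
    norm is the distance of that fiber.\<close>
  define x where "x i = x' i - proj (x' i) (x' i)" for i
  have Vx: "V (x i) = V (x' i)" for i
    using V_eq[of "x i" "x' i"] proj_in[of "x' i" "x' i"] subspace_V[of "x' i"]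
    by (simp add: x_def subspace_neg)
  have orth: "x i \<bullet> v = 0" if "v \<in> V (x i)" for i v
    using proj_orth[of v "x' i" "x' i"] that by (simp add: x_def Vx[unfolded x_def])
  have big: "real i < norm (x i)" for i using x' by (simp add: x_def)
  then have x0: "x i \<noteq> 0" for i by (metis norm_zero not_less of_nat_0_le_iff)
  \<comment> \<open>The cone over the fiber with the height coordinate forgotten.\<close>
  define W' where "W' i = span (insert (x i) (V (x i)))" for i
  have "\<exists>f. f ` {..<k+1} \<subseteq> W' i \<and> (\<forall>j<k+1. norm (f j) = 1) \<and>
          (\<forall>j<k+1. \<forall>l<k+1. j \<noteq> l \<longrightarrow> f j \<bullet> f l = 0)" for i
  proof -
    have "x i \<notin> span (V (x i))"
      using orth[of "x i" i] x0[of i] by (auto simp: span_V)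
    then have dW: "dim (W' i) = k + 1" by (simp add: W'_def dim_insert dim)
    obtain B where B: "B \<subseteq> W' i" "pairwise orthogonal B" "\<And>b. b \<in> B \<Longrightarrow> norm b = 1"
        "independent B" "card B = dim (W' i)" "span B = W' i"
      by (rule orthonormal_basis_subspace[of "W' i"]) (simp_all add: W'_def)
    then obtain f where f: "bij_betw f {..<k+1} B"
      using ex_bij_betw_nat_finite[of B] dW independent_imp_finite
      by (metis atLeast0LessThan)
    have "f j \<noteq> f l" if "j < k+1" "l < k+1" "j \<noteq> l" for j l
      using f that by (auto simp: bij_betw_def inj_on_def)
    moreover have fB: "f j \<in> B" if "j < k+1" for j using f that by (auto simp: bij_betw_def)
    ultimately show ?thesis
      using B by (intro exI[of _ f]) (auto simp: pairwise_def orthogonal_def)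
  qed
  then obtain b where b: "\<And>i j. j < k+1 \<Longrightarrow> b i j \<in> W' i" "\<And>i j. j < k+1 \<Longrightarrow> norm (b i j) = 1"
      "\<And>i j l. j < k+1 \<Longrightarrow> l < k+1 \<Longrightarrow> j \<noteq> l \<Longrightarrow> b i j \<bullet> b i l = 0"
    by (metis image_subset_iff lessThan_iff)
  obtain l r where r: "strict_mono r" and l: "\<And>j. j < k+1 \<Longrightarrow> (\<lambda>i. b (r i) j) \<longlonglongrightarrow> l j"
    using convergent_subsequence_finite[of "k+1" b 1] b(2) by (metis order_refl)
  \<comment> \<open>Orthonormality passes to the limit, so the dimension does not drop.\<close>
  have l1: "norm (l j) = 1" if "j < k+1" for j
    using LIMSEQ_unique[OF tendsto_norm[OF l[OF that]]] b(2)[OF that] by simp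
  have lo: "l i \<bullet> l j = 0" if "i < k+1" "j < k+1" "i \<noteq> j" for i j
    using LIMSEQ_unique[OF tendsto_inner[OF l[OF that(1)] l[OF that(2)]]] b(3)[OF that] by simp
  let ?B = "l ` {..<k+1}"
  have inj: "inj_on l {..<k+1}"
  proof (rule inj_onI)
    fix i j assume "i \<in> {..<k+1}" "j \<in> {..<k+1}" "l i = l j"
    then show "i = j" using lo[of i j] l1[of j] by (cases "i = j") auto
  qed
  have "pairwise orthogonal ?B" using lo by (auto simp: pairwise_def orthogonal_def)
  moreover have "0 \<notin> ?B" using l1 by force
  ultimately have "independent ?B" by (rule pairwise_orthogonal_independent)
  then have "dim (span ?B) = k + 1"
    using inj by (simp add: dim_eq_card_independent card_image del: Suc_eq_plus1)
  moreover have "w = 0" if w: "w \<in> V q" "w \<in> span ?B" for q w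
  proof (rule ccontr)
    assume w0: "w \<noteq> 0"
    obtain e where e: "e > 0" and near: "\<And>y v t. v \<in> V y \<Longrightarrow>
        dist (t *\<^sub>R y + v, t) (w, 0) < e \<Longrightarrow> \<exists>z. dist q z < 1 \<and> z - y \<in> V y"
      using cones_near_fiber[OF w(1) w0] by blast
    obtain c where "w = (\<Sum>a\<in>?B. c a *\<^sub>R a)" using w(2) by (auto simp: span_finite)
    then have wc: "w = (\<Sum>j<k+1. c (l j) *\<^sub>R l j)"
      by (subst (asm) sum.reindex[OF inj]) (simp add: o_def)
    \<comment> \<open>Keeping the coefficients of \<open>w\<close> but using the approximating bases
      gives vectors of \<open>W' (r i)\<close> converging to \<open>w\<close>; \<open>t i\<close>
      below is the height of the cone point over \<open>w' i\<close>.\<close>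
    define w' where "w' i = (\<Sum>j<k+1. c (l j) *\<^sub>R b (r i) j)" for i
    have lim: "w' \<longlonglongrightarrow> w" unfolding wc w'_def by (intro tendsto_intros l) simp
    have "w' i \<in> W' (r i)" for i
      unfolding w'_def W'_def
      by (intro span_sum span_scale) (use b(1) in \<open>auto simp: W'_def\<close>)
    then have "\<exists>t. w' i - t *\<^sub>R x (r i) \<in> span (V (x (r i)))" for i
      by (simp add: W'_def span_insert)
    then obtain t where t: "\<And>i. w' i - t i *\<^sub>R x (r i) \<in> V (x (r i))"
      unfolding span_V by metis
    have tw: "\<bar>t i\<bar> * norm (x (r i)) \<le> norm (w' i)" for i
    proof -
      have "norm (x (r i)) * (\<bar>t i\<bar> * norm (x (r i))) = \<bar>x (r i) \<bullet> w' i\<bar>"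
        using orth[OF t[of i]]
        by (simp add: inner_diff_right abs_mult dot_square_norm power2_eq_square)
      also have "\<dots> \<le> norm (x (r i)) * norm (w' i)" by (rule Cauchy_Schwarz_ineq2)
      finally show ?thesis using x0 by simp
    qed
    \<comment> \<open>The height is at most \<open>norm (w' i) / norm (x (r i))\<close>, with
      bounded numerator and denominator at least \<open>i\<close>.\<close>
    have t0: "t \<longlonglongrightarrow> 0"
    proof (rule Lim_null_comparison)
      have "norm (t i) \<le> norm (w' i) * inverse (real i)" if "i > 0" for i
      proof -
        have "real i \<le> norm (x (r i))"
          using big[of "r i"] seq_suble[OF r, of i] by linarith
        then have "\<bar>t i\<bar> * real i \<le> norm (w' i)"
          using tw[of i] by (meson abs_ge_zero mult_left_mono order_trans)
        then show ?thesis using that by (simp add: field_simps)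
      qed
      then show "\<forall>\<^sub>F i in sequentially. norm (t i) \<le> norm (w' i) * inverse (real i)"
        using eventually_gt_at_top[of 0] by (rule eventually_mono[rotated])
      show "(\<lambda>i. norm (w' i) * inverse (real i)) \<longlonglongrightarrow> 0"
        using tendsto_mult[OF tendsto_norm[OF lim] lim_inverse_n] by simp
    qed
    have "(\<lambda>i. (w' i, t i)) \<longlonglongrightarrow> (w, 0)" using lim t0 by (rule tendsto_Pair)
    then have "\<forall>\<^sub>F i in sequentially. dist (w' i, t i) (w, 0) < e" using e by (rule tendstoD)
    moreover have "\<forall>\<^sub>F i in sequentially. norm q + 1 < real i"
      using filterlim_real_sequentially by (simp add: filterlim_at_top_dense)
    ultimately have "\<forall>\<^sub>F i in sequentially. False"
    proof eventually_elim
      fix i assume d: "dist (w' i, t i) (w, 0) < e" and i: "norm q + 1 < real i"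
      let ?x = "x (r i)"
      obtain z where z: "dist q z < 1" "z - ?x \<in> V ?x"
        using near[OF t[of i], of "t i"] d by auto
      \<comment> \<open>\<open>z\<close> lies on the fiber whose nearest point to 0 is
        \<open>?x\<close>, so \<open>norm ?x\<close> is at most \<open>norm z\<close>, which is
        below \<open>norm q + 1\<close>.\<close>
      have "norm ?x * norm ?x = ?x \<bullet> z"
        using orth[OF z(2)] by (simp add: inner_diff_right dot_square_norm power2_eq_square)
      also have "\<dots> \<le> norm ?x * norm z" by (rule norm_cauchy_schwarz)
      finally have "norm ?x \<le> norm z" using x0 by simp
      moreover have "norm z \<le> norm q + dist q z"
        using norm_triangle_ineq2[of z q] by (simp add: dist_norm norm_minus_commute)
      ultimately show False
        using z(1) i big[of "r i"] seq_suble[OF r, of i] by linarith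
    qed
    then show False by simp
  qed
  ultimately show ?thesis
    using subspace_V subspace_0 by (intro exI[of _ "span ?B"]) (auto simp: span_zero)
qed

end

section \<open>Directions of the fibers\<close>

lemma lin_part_subspace:
  assumes "subspace W"
  shows "lin_part W = W"
proof -
  have "w \<in> lin_part W" if "w \<in> W" for w
    unfolding lin_part_def mem_Collect_eq using that subspace_0[OF assms]
    by - (rule exI[of _ w], rule exI[of _ 0], auto)
  then show ?thesis using subspace_diff[OF assms] by (auto simp: lin_part_def)
qed

lemma lin_part_frame_points: "lin_part (frame_points k f) = span (snd f ` {..<k})"
proof -
  have fp: "fst f + u \<in> frame_points k f" if "u \<in> span (snd f ` {..<k})" for u
    unfolding frame_points_def using that by blast
  have "u \<in> lin_part (frame_points k f)" if "u \<in> span (snd f ` {..<k})" for u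
    unfolding lin_part_def mem_Collect_eq using fp[OF that] fp[OF span_zero]
    by - (rule exI[of _ "fst f + u"], rule exI[of _ "fst f + 0"], auto)
  then show ?thesis
    by (auto simp: lin_part_def frame_points_def span_diff)
qed

text \<open>A permutation other than the identity moves some index and contributes a zero factor.
  The identity matrix then witnesses reflexivity of \<open>same_oplane\<close>.\<close>

lemma ldet_delta: "ldet k (\<lambda>i j. if i = j then 1 else 0) = 1"
proof -
  have "(\<Prod>i<k. if i = \<sigma> i then 1 else (0::real)) = (if \<sigma> = id then 1 else 0)"
    if "\<sigma> permutes {..<k}" for \<sigma>
  proof (cases "\<forall>i<k. \<sigma> i = i")
    case True
    have "\<sigma> i = i" for i using True permutes_not_in[OF that, of i] by (cases "i < k") auto
    then have "\<sigma> = id" by auto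
    then show ?thesis by simp
  next
    case False
    then obtain i where i: "i < k" "i \<noteq> \<sigma> i" by metis
    then have "\<sigma> \<noteq> id" by auto
    then show ?thesis using i by (auto intro!: prod_zero bexI[of _ i])
  qed
  then have "ldet k (\<lambda>i j. if i = j then 1 else 0)
      = (\<Sum>\<sigma> | \<sigma> permutes {..<k}. if \<sigma> = id then 1 else 0)"
    unfolding ldet_def by (intro sum.cong) auto
  also have "\<dots> = 1"
    by (subst sum.delta) (simp_all add: finite_permutations permutes_id)
  finally show ?thesis .
qed

lemma same_oplane_refl:
  assumes "f \<in> oframes k"
  shows "same_oplane k f f"
proof -
  have "snd f j = (\<Sum>i<k. (if i = j then 1 else 0) *\<^sub>R snd f i)" if "j < k" for j
    using that by (simp add: if_distrib[of "\<lambda>c. c *\<^sub>R _"] cong: if_cong)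
  then show ?thesis
    using assms ldet_delta[of k] unfolding same_oplane_def oframes_def
    by (auto intro!: exI[of _ "\<lambda>i j. if i = j then 1 else 0"])
qed

lemma opoints_oplane:
  assumes "f \<in> oframes k"
  shows "opoints k (oplane k f) = frame_points k f"
  using same_oplane_refl[OF assms] by (auto simp: opoints_def oplane_def same_oplane_def)

text \<open>Lifted to frames, the projection onto the direction is the Gram-Schmidt formula, which
  is continuous. It therefore has open preimages in the quotient topology, and these pull back along
  the fibration.\<close>

lemma oriented_fibration_direction_continuous:
  fixes \<F> :: "'a::euclidean_space oframe set set"
  assumes fib: "oriented_fibration k \<F>" and mem: "\<And>x. fiber_through k \<F> x \<in> \<F>"
  shows "continuous_on UNIV (\<lambda>x. closest_point (lin_part (opoints k (fiber_through k \<F> x))) u)"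
  unfolding continuous_on_open_vimage[OF open_UNIV]
proof (intro allI impI)
  fix T :: "'a set" assume T: "open T"
  define S where "S = {P \<in> OAGr k. closest_point (lin_part (opoints k P)) u \<in> T}"
  have "continuous_on (oframes k) (\<lambda>f :: 'a oframe. gram_schmidt_proj k (snd f) u)"
  proof (rule continuous_on_gram_schmidt_proj)
    show "continuous_on (oframes k) (\<lambda>f :: 'a oframe. snd f i)" for i
      by (rule continuous_on_compose2[OF continuous_on_product_coordinates[of i]])
        (auto intro: continuous_intros)
  qed (auto simp: oframes_def is_oframe_def)
  then have "openin (top_of_set (oframes k))
      (oframes k \<inter> (\<lambda>f :: 'a oframe. gram_schmidt_proj k (snd f) u) -` T)"
    using T by (rule continuous_openin_preimage_gen)
  also have "oframes k \<inter> (\<lambda>f. gram_schmidt_proj k (snd f) u) -` T = {f \<in> oframes k. oplane k f \<in> S}"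
    by (auto simp: S_def OAGr_def opoints_oplane lin_part_frame_points gram_schmidt_proj_eq)
  finally have "oagr_open k S" by (auto simp: oagr_open_def S_def)
  then have "open {x. fiber_through k \<F> x \<in> S}" using fib by (simp add: oriented_fibration_def)
  also have "{x. fiber_through k \<F> x \<in> S} =
      (\<lambda>x. closest_point (lin_part (opoints k (fiber_through k \<F> x))) u) -` T \<inter> UNIV"
    using fib mem by (auto simp: S_def oriented_fibration_def)
  finally show "open \<dots>" .
qed

section \<open>The fibration as a skew field of planes\<close>

theorem theorem1p3:
  fixes \<F> :: "'a::euclidean_space oframe set set" and k :: nat
  assumes "k < DIM('a)"
    and "oriented_fibration k \<F>"
    and "skew_fibration k \<F>"
  shows "\<exists>A :: 'a set. affine A \<and> aff_dim A = int (k + 1) \<and>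
           (\<forall>P\<in>\<F>. transverse A (opoints k P))"
proof -
  let ?P = "fiber_through k \<F>"
  define V where "V x = lin_part (opoints k (?P x))" for x
  have fiber: "?P x = P" if "P \<in> \<F>" "x \<in> opoints k P" for x P
    unfolding fiber_through_def
    using that assms(2) by (intro the_equality) (auto simp: oriented_fibration_def)
  have cover: "\<exists>P\<in>\<F>. x \<in> opoints k P" for x using assms(2) by (auto simp: oriented_fibration_def)
  have mem: "?P x \<in> \<F>" "x \<in> opoints k (?P x)" for x
    by (metis cover fiber)+
  have frame: "\<exists>f\<in>oframes k. opoints k P = frame_points k f \<and>
      lin_part (opoints k P) = span (snd f ` {..<k})" if "P \<in> \<F>" for P
  proof -
    have "P \<in> oplane k ` oframes k"
      using that assms(2) by (auto simp: oriented_fibration_def OAGr_def)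
    then show ?thesis by (auto simp: opoints_oplane lin_part_frame_points)
  qed
  have sub: "subspace (V x)" for x
    using frame[OF mem(1)[of x]] by (auto simp: V_def)
  have dimV: "dim (V x) = k" for x
  proof -
    obtain f where f: "f \<in> oframes k" "V x = span (snd f ` {..<k})"
      using frame[OF mem(1)[of x]] by (auto simp: V_def)
    then show ?thesis
      by (simp add: oframes_def is_oframe_def dim_eq_card_independent card_image)
  qed
  \<comment> \<open>The base point of the frame may be moved to any point \<open>x\<close> of the
    fiber.\<close>
  have pts: "opoints k (?P x) = (\<lambda>v. x + v) ` V x" for x
  proof -
    obtain f where f: "opoints k (?P x) = frame_points k f" "V x = span (snd f ` {..<k})"
      using frame[OF mem(1)[of x]] by (auto simp: V_def)
    obtain a where a: "x = fst f + a" "a \<in> V x"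
      using mem(2)[of x] f by (auto simp: frame_points_def)
    have "fst f + v \<in> (\<lambda>v. x + v) ` V x" if "v \<in> V x" for v
      using a that sub by (intro image_eqI[of _ _ "v - a"]) (auto intro: subspace_diff)
    moreover have "x + v \<in> frame_points k f" if "v \<in> V x" for v
      unfolding frame_points_def using a that sub f(2)
      by (auto intro!: exI[of _ "a + v"] span_add simp: add.assoc)
    ultimately show ?thesis using f by (auto simp: frame_points_def)
  qed
  interpret skew_field V
  proof
    show "subspace (V x)" for x by (rule sub)
    show "continuous_on UNIV (\<lambda>x. closest_point (V x) u)" for u
      unfolding V_def using assms(2) mem(1) by (rule oriented_fibration_direction_continuous)
    have same: "?P y = ?P x" if "y - x \<in> V x" for x y
      using that by (intro fiber mem) (auto simp: pts intro!: image_eqI[of _ _ "y - x"])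
    then show "V y = V x" if "y - x \<in> V x" for x y
      using that by (simp add: V_def)
    show "y - x \<in> V x" if u: "u \<in> V x" "u \<in> V y" "u \<noteq> 0" for u x y
    proof -
      \<comment> \<open>A common direction \<open>u\<close> yields parallel lines through
        \<open>x\<close> and \<open>y\<close> inside their fibers, so skewness identifies the
        fibers.\<close>
      have "range (\<lambda>t. z + t *\<^sub>R u) \<subseteq> opoints k (?P z)" if "u \<in> V z" for z
        using that sub by (auto simp: pts intro: subspace_scale)
      then have "?P x = ?P y"
        using assms(3) mem(1) u unfolding skew_fibration_def by metis
      then have "y \<in> opoints k (?P x)" using mem(2)[of y] by simp
      then show ?thesis by (auto simp: pts)
    qed
  qed
  obtain W where W: "subspace W" "dim W = k + 1" "\<And>q. V q \<inter> W = {0}"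
    using transverse_plane_exists[OF dimV assms(1)] by blast
  have "transverse W (opoints k P)" if P: "P \<in> \<F>" for P
  proof -
    obtain f where "opoints k P = frame_points k f" using frame[OF P] by auto
    then have "fst f \<in> opoints k P"
      by (auto simp: frame_points_def intro!: exI[of _ 0] span_zero)
    then have "V (fst f) = lin_part (opoints k P)" using fiber[OF P] by (simp add: V_def)
    then show ?thesis
      using W(1) W(3)[of "fst f"] by (simp add: transverse_def lin_part_subspace Int_commute)
  qed
  then show ?thesis
    using W(1,2) subspace_imp_affine[OF W(1)] aff_dim_subspace[OF W(1)] by (intro exI[of _ W]) auto
qed

end
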